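(* Let $\kappa\in\{B,E\}$, let $\boldsymbol{\phi}_\kappa=\{\boldsymbol{\alpha},\boldsymbol{\beta},\boldsymbol{\chi}_\kappa,\boldsymbol{\delta}_\kappa\}$ be any choice of encoder and decoder parameters, and let $\mathbf{s}$, $\mathbf{y}_\kappa$, $h_\kappa$ be the random source sentence, received signal and channel coefficient of the communication model described in the context. Let $q_{\boldsymbol{\phi}_\kappa}(\cdot\mid \mathbf{y}_\kappa,h_\kappa)$ be the probability distribution on the set of sentences output by the receiver's decoder given $(\mathbf{y}_\kappa,h_\kappa)$. Then, for (almost) every realization of $h_\kappa$, the mutual information between $\mathbf{s}$ and $\mathbf{y}_\kappa$ given that realization satisfies $$I(\mathbf{s};\mathbf{y}_\kappa\mid h_\kappa)\;\ge\; H(\mathbf{s})+\mathbb{E}_{p(\mathbf{s},\mathbf{y}_\kappa\mid h_\kappa)}\left\{\log q_{\boldsymbol{\phi}_\kappa}(\mathbf{s}\mid \mathbf{y}_\kappa,h_\kappa)\right\}\;=\;H(\mathbf{s})-\mathbb{E}_{p(\mathbf{y}_\kappa\mid h_\kappa)}\left\{\mathcal{L}_{\mathrm{CE}}(\mathbf{s},\hat{\mathbf{s}}_\kappa)\right\},$$ where $\mathcal{L}_{\mathrm{CE}}(\mathbf{s},\hat{\mathbf{s}}_\kappa)$ is the cross entropy of the decoder distribution relative to the true posterior of $\mathbf{s}$, $$\mathcal{L}_{\mathrm{CE}}(\mathbf{s},\hat{\mathbf{s}}_\kappa)=-\mathbb{E}_{p(\mathbf{s}\mid \mathbf{y}_\kappa,h_\kappa)}\left\{\log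 q_{\boldsymbol{\phi}_\kappa}(\mathbf{s}\mid \mathbf{y}_\kappa,h_\kappa)\right\}.$$
   Context: Communication model. The source sentence $\mathbf{s}=[w_1,\dots,w_L]$ is a random sequence of $L$ words from a finite vocabulary, so $\mathbf{s}$ takes values in a finite set $\mathcal{S}$. The transmitter sends $\mathbf{x}=T^C(T^S(\mathbf{s};\boldsymbol{\alpha});\boldsymbol{\beta})\in\mathbb{C}^{M}$, where $T^S(\cdot;\boldsymbol{\alpha})$ (semantic encoder) and $T^C(\cdot;\boldsymbol{\beta})$ (channel encoder) are deterministic functions with parameters $\boldsymbol{\alpha},\boldsymbol{\beta}$. There are two receivers, indexed by $\kappa\in\{B,E\}$ (the legitimate receiver and the eavesdropper). Receiver $\kappa$ observes $\mathbf{y}_\kappa=\sqrt{P}\,h_\kappa\mathbf{x}+\mathbf{w}_\kappa\in\mathbb{C}^M$, where $P>0$ is the transmit power, $h_\kappa$ is a random complex scalar channel coefficient, and $\mathbf{w}_\kappa$ is zero-mean additive white Gaussian noise with variance $\mathcal{N}>0$ per component. The random variables $\mathbf{s}$, $h_\kappa$, $\mathbf{w}_\kappa$ are independent. Decoder. Receiver $\kappa$ applies a channel decoder with parameters $\boldsymbol{\chi}_\kappa$ followed by a semantic decoder with parameters $\boldsymbol{\delta}_\kappa$ to produce the recovered sentence $\hat{\mathbf{s}}_\kappa$. The decoder is viewed as a (measurable) conditional probability distribution: $q_{\boldsymbol{\phi}_\kappa}(s\mid y,h)$ denotes the probability that it assigns to the sentence $s\in\mathcal{S}$ being the recovered sentence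 $\hat{\mathbf{s}}_\kappa$ when $\mathbf{y}_\kappa=y$, $h_\kappa=h$; thus $q_{\boldsymbol{\phi}_\kappa}(s\mid y,h)\ge 0$ and $\sum_{s\in\mathcal{S}}q_{\boldsymbol{\phi}_\kappa}(s\mid y,h)=1$. Notation. $p(\cdot)$ denotes the true probability laws of the model (joint, conditional, posterior). $I(\mathbf{s};\mathbf{y}_\kappa\mid h_\kappa)$ is the mutual information of $\mathbf{s}$ and $\mathbf{y}_\kappa$ under the conditional joint law $p(\mathbf{s},\mathbf{y}_\kappa\mid h_\kappa)$ for a fixed realization of $h_\kappa$ (no averaging over $h_\kappa$), i.e. $I(\mathbf{s};\mathbf{y}_\kappa\mid h_\kappa)=\mathbb{E}_{p(\mathbf{s},\mathbf{y}_\kappa\mid h_\kappa)}\{\log (p(\mathbf{s}\mid\mathbf{y}_\kappa,h_\kappa)/p(\mathbf{s}\mid h_\kappa))\}$. $H(\mathbf{s})$ is the Shannon entropy of $\mathbf{s}$. Conventions: $\log 0=-\infty$ and $0\log 0=0$; $\mathcal{L}_{\mathrm{CE}}$ may equal $+\infty$, in which case the lower bound may be $-\infty$. *)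

theory Defs
  imports "HOL-Probability.Probability"
begin

text \<open>Receivers: \<open>Bob\<close> is the legitimate receiver, \<open>Eve\<close> the eavesdropper.\<close>

datatype receiver = Bob | Eve

definition sentences :: "'v set \<Rightarrow> nat \<Rightarrow> 'v list set" where
  "sentences V L = {ws. set ws \<subseteq> V \<and> length ws = L}"

definition transmitted ::
  "('a \<Rightarrow> 'v list \<Rightarrow> 'f) \<Rightarrow> ('b \<Rightarrow> 'f \<Rightarrow> (complex ^ 'm)) \<Rightarrow> 'a \<Rightarrow> 'b \<Rightarrow> 'v list \<Rightarrow> (complex ^ 'm)" where
  "transmitted TS TC \<alpha> \<beta> ws = TC \<beta> (TS \<alpha> ws)"

definition received ::
  "real \<Rightarrow> ('v list \<Rightarrow> (complex ^ 'm)) \<Rightarrow> ('w \<Rightarrow> 'v list) \<Rightarrow> ('w \<Rightarrow> complex) \<Rightarrow> ('w \<Rightarrow> (complex ^ 'm))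
    \<Rightarrow> 'w \<Rightarrow> (complex ^ 'm)" where
  "received P x s h n \<omega> = (complex_of_real (sqrt P) * h \<omega>) *s x (s \<omega>) + n \<omega>"

text \<open>Density, with respect to Lebesgue measure on the real vector space underlying
  \<open>complex ^ 'm\<close>, of white circularly symmetric Gaussian noise: the components are independent,
  and each has variance \<open>N\<close>, split equally between independent real and imaginary parts.\<close>

definition awgn_density :: "real \<Rightarrow> (complex ^ 'm) \<Rightarrow> real" where
  "awgn_density N z =
    (\<Prod>i\<in>UNIV. normal_density 0 (sqrt (N / 2)) (Re (z $ i)) * normal_density 0 (sqrt (N / 2)) (Im (z $ i)))"

text \<open>Mutual independence of three random variables whose value types may differ; the constant
  \<open>indep_vars\<close> requires a common value type, so this is stated for the generated
  \<open>\<sigma>\<close>-algebras, as in the definition of \<open>indep_vars\<close>.\<close>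

definition preimages :: "'w measure \<Rightarrow> 'c measure \<Rightarrow> ('w \<Rightarrow> 'c) \<Rightarrow> 'w set set" where
  "preimages M A X = {X -` S \<inter> space M | S. S \<in> sets A}"

definition indep_vars3 ::
  "'w measure \<Rightarrow> 'x measure \<Rightarrow> ('w \<Rightarrow> 'x) \<Rightarrow> 'y measure \<Rightarrow> ('w \<Rightarrow> 'y) \<Rightarrow> 'z measure \<Rightarrow> ('w \<Rightarrow> 'z) \<Rightarrow> bool" where
  "indep_vars3 M A X B Y C Z \<longleftrightarrow>
    X \<in> measurable M A \<and> Y \<in> measurable M B \<and> Z \<in> measurable M C \<and>
    prob_space.indep_sets M (\<lambda>i::nat. [preimages M A X, preimages M B Y, preimages M C Z] ! i) {0, 1, 2}"

text \<open>\<open>K\<close> is a version of the regular conditional distribution of \<open>X\<close> given \<open>Y\<close>.\<close>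

definition regular_cond_distr ::
  "'w measure \<Rightarrow> 'x measure \<Rightarrow> ('w \<Rightarrow> 'x) \<Rightarrow> 'y measure \<Rightarrow> ('w \<Rightarrow> 'y) \<Rightarrow> ('y \<Rightarrow> 'x measure) \<Rightarrow> bool" where
  "regular_cond_distr M A X B Y K \<longleftrightarrow>
    X \<in> measurable M A \<and> Y \<in> measurable M B \<and> K \<in> measurable B (prob_algebra A) \<and>
    (\<forall>S\<in>sets A. \<forall>T\<in>sets B.
      emeasure M {\<omega> \<in> space M. X \<omega> \<in> S \<and> Y \<omega> \<in> T} = (\<integral>\<^sup>+ y\<in>T. emeasure (K y) S \<partial>distr M B Y))"

definition decoder_distribution ::
  "'s set \<Rightarrow> ('s \<Rightarrow> (complex ^ 'm) \<Rightarrow> complex \<Rightarrow> real) \<Rightarrow> bool" where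
  "decoder_distribution S q \<longleftrightarrow>
    (\<forall>w\<in>S. (\<lambda>(y, h). q w y h) \<in> borel_measurable (borel \<Otimes>\<^sub>M borel)) \<and>
    (\<forall>y h. (\<forall>w\<in>S. 0 \<le> q w y h) \<and> (\<Sum>w\<in>S. q w y h) = 1)"

text \<open>Logarithm to base \<open>b\<close> with value \<open>-\<infinity>\<close> at \<open>0\<close>; the library's \<open>log b 0\<close> is \<open>0\<close>.\<close>

definition elog :: "real \<Rightarrow> real \<Rightarrow> ereal" where
  "elog b x = (if x = 0 then -\<infinity> else ereal (log b x))"

text \<open>Expectation of an extended real function as the integral of its positive part minus that of
  its negative part (\<open>e2ennreal\<close> maps negative numbers to \<open>0\<close>). It is applied only to
  functions of constant sign, so \<open>\<infinity> - \<infinity>\<close> does not arise. The integral of \<open>\<infinity>\<close> over a null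
  set is \<open>0\<close>, which is the convention \<open>0 log 0 = 0\<close>.\<close>

definition ereal_expectation :: "'c measure \<Rightarrow> ('c \<Rightarrow> ereal) \<Rightarrow> ereal" where
  "ereal_expectation M f =
    enn2ereal (\<integral>\<^sup>+ x. e2ennreal (f x) \<partial>M) - enn2ereal (\<integral>\<^sup>+ x. e2ennreal (- f x) \<partial>M)"

text \<open>Mutual information of the two components of a joint law \<open>J\<close> on sentences and received
  signals. The density of \<open>J\<close> with respect to the product of its marginals, whose logarithm is
  integrated here, is the ratio of the posterior to the prior probability of the sentence.\<close>

definition mutual_info_of_law :: "real \<Rightarrow> 's set \<Rightarrow> ('s \<times> (complex ^ 'm)) measure \<Rightarrow> real" where
  "mutual_info_of_law b S J = prob_space.mutual_information J b (count_space S) borel fst snd"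

text \<open>Here \<open>post\<close> is the posterior law of the sentence given \<open>(y, h)\<close>.\<close>

definition cross_entropy_loss ::
  "real \<Rightarrow> ((complex ^ 'm) \<times> complex \<Rightarrow> 's measure) \<Rightarrow> ('s \<Rightarrow> (complex ^ 'm) \<Rightarrow> complex \<Rightarrow> real)
    \<Rightarrow> (complex ^ 'm) \<Rightarrow> complex \<Rightarrow> ereal" where
  "cross_entropy_loss b post q y h = - ereal_expectation (post (y, h)) (\<lambda>w. elog b (q w y h))"

end

theory Submission
  imports Defs
begin

text \<open>Since \<open>h\<close> is independent of \<open>s\<close>, for almost every \<open>h\<close> the sentence marginal of the
  conditional joint law is the law of \<open>s\<close>, and the law itself disintegrates over its
  signal marginal \<open>p(y | h)\<close> with kernel \<open>r = p(\<cdot> | y, h)\<close>, the posterior. Hence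
  \<open>I(s; y | h) = H(s) + E (\<Sum>w. r w * log (r w))\<close>, the expectation being over \<open>p(y | h)\<close>.
  Gibbs' inequality \<open>\<Sum>w. r w * log (r w) \<ge> \<Sum>w. r w * log (q w)\<close> for each \<open>y\<close> gives the bound.
  Negated, both sums have nonnegative terms, so the comparison is made between
  \<open>[0, \<infinity>]\<close>-valued integrals, and an infinite cross entropy needs no separate treatment.\<close>

section \<open>Extended logarithms and expectations of functions of one sign\<close>

lemma elog_nonpos: "elog b x \<le> 0" if "b > 1" "0 \<le> x" "x \<le> 1"
  using that by (auto simp: elog_def zero_ereal_def)

lemma measurable_elog [measurable]: "elog b \<in> borel_measurable borel"
  unfolding elog_def by measurable

lemma ereal_expectation_nonpos:
  assumes "\<And>x. x \<in> space M \<Longrightarrow> f x \<le> 0"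
  shows "ereal_expectation M f = - enn2ereal (\<integral>\<^sup>+ x. e2ennreal (- f x) \<partial>M)"
proof -
  have "(\<integral>\<^sup>+ x. e2ennreal (f x) \<partial>M) = (\<integral>\<^sup>+ x. 0 \<partial>M)"
    using assms by (intro nn_integral_cong) (simp add: e2ennreal_neg)
  then show ?thesis
    by (simp add: ereal_expectation_def zero_ennreal.rep_eq)
qed

lemma ereal_expectation_enn2ereal:
  "ereal_expectation M (\<lambda>x. enn2ereal (f x)) = enn2ereal (\<integral>\<^sup>+ x. f x \<partial>M)"
proof -
  have "(\<integral>\<^sup>+ x. e2ennreal (- enn2ereal (f x)) \<partial>M) = (\<integral>\<^sup>+ x. 0 \<partial>M)"
    by (intro nn_integral_cong) (simp add: e2ennreal_neg)
  then show ?thesis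
    by (simp add: ereal_expectation_def zero_ennreal.rep_eq)
qed

section \<open>Gibbs' inequality with infinite values\<close>

lemma mult_log_diff_le:
  fixes r q b :: real
  assumes "b > 1" "r \<ge> 0" "q \<ge> 0" "r > 0 \<Longrightarrow> q > 0"
  shows "r * log b q - r * log b r \<le> (q - r) / ln b"
proof (cases "r = 0")
  case False
  then have pos: "r > 0" "q > 0" using assms by auto
  \<comment> \<open>The tangent to \<open>ln\<close> at 1 bounds it from above; it is evaluated at
    the ratio \<open>q / r\<close>. Weighting by \<open>r\<close> leaves a bound linear in both
    masses, which cancels when summed over two probability vectors.\<close>
  have "r * ln (q / r) \<le> r * (q / r - 1)"
    using pos by (intro mult_left_mono ln_le_minus_one) auto
  then have "r * (ln q - ln r) \<le> q - r"
    using pos by (simp add: ln_div algebra_simps)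
  then have "r * (ln q - ln r) / ln b \<le> (q - r) / ln b"
    using assms(1) by (intro divide_right_mono) auto
  then show ?thesis
    by (simp add: log_def algebra_simps diff_divide_distrib)
qed (use assms in auto)

text \<open>If some \<open>w\<close> has \<open>r w > 0\<close> but \<open>q w = 0\<close>, its term
  on the right is infinite and nothing is left to prove. Otherwise every term is a finite number,
  and summing the pointwise bound of \<open>mult_log_diff_le\<close> leaves
  \<open>(1 - 1) / ln b = 0\<close>. Working in \<open>ennreal\<close> lets both cases share one
  statement.\<close>

lemma gibbs_ennreal:
  fixes r q :: "'s \<Rightarrow> real"
  assumes b: "b > 1" and S: "finite S"
    and r: "\<And>w. w \<in> S \<Longrightarrow> 0 \<le> r w" "(\<Sum>w\<in>S. r w) = 1"
    and q: "\<And>w. w \<in> S \<Longrightarrow> 0 \<le> q w" "(\<Sum>w\<in>S. q w) = 1"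
  shows "(\<Sum>w\<in>S. ennreal (- (r w * log b (r w)))) \<le> (\<Sum>w\<in>S. ennreal (r w) * e2ennreal (- elog b (q w)))"
proof (cases "\<exists>w\<in>S. r w > 0 \<and> q w = 0")
  case True
  then obtain v where v: "v \<in> S" "r v > 0" "q v = 0" by auto
  have "ennreal (r v) * e2ennreal (- elog b (q v)) = \<top>"
    using v by (simp add: elog_def ennreal_mult_top)
  moreover have "ennreal (r v) * e2ennreal (- elog b (q v)) \<le> (\<Sum>w\<in>S. ennreal (r w) * e2ennreal (- elog b (q w)))"
    using v S by (intro member_le_sum) auto
  ultimately show ?thesis by (simp add: top_unique)
next
  case False
  have r1: "r w \<le> 1" and q1: "q w \<le> 1" if "w \<in> S" for w
    using member_le_sum[of w S r] member_le_sum[of w S q] that S r q by auto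
  \<comment> \<open>Where \<open>r w = 0\<close> both sides are 0, even if \<open>q w = 0\<close>
    makes the logarithm infinite, because \<open>0 * top = 0\<close> in
    \<open>ennreal\<close>.\<close>
  have *: "ennreal (r w) * e2ennreal (- elog b (q w)) = ennreal (- (r w * log b (q w)))" if "w \<in> S" for w
  proof (cases "r w = 0")
    case False
    then have "q w > 0" "r w > 0"
      using \<open>\<not> (\<exists>w\<in>S. r w > 0 \<and> q w = 0)\<close> r(1)[OF that] q(1)[OF that] that by force+
    then show ?thesis
      using q1[OF that] b by (simp add: elog_def flip: ennreal_mult)
  qed simp
  \<comment> \<open>\<open>ennreal\<close> sends negative reals to 0. The signs recorded here
    exclude such truncation, so the inequality between real sums carries over to the sums in
    \<open>ennreal\<close>.\<close>
  have le0: "r w * log b (r w) \<le> 0" "r w * log b (q w) \<le> 0" if "w \<in> S" for w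
  proof -
    have "log b x \<le> 0" if "0 \<le> x" "x \<le> 1" for x
      using that b by (cases "x = 0") (simp_all add: log_def divide_nonpos_pos)
    then show "r w * log b (r w) \<le> 0" "r w * log b (q w) \<le> 0"
      using r(1) q(1) r1 q1 that by (auto simp: mult_nonneg_nonpos)
  qed
  have "(\<Sum>w\<in>S. r w * log b (q w) - r w * log b (r w)) \<le> (\<Sum>w\<in>S. (q w - r w) / ln b)"
    using b r(1) q(1) False by (intro sum_mono mult_log_diff_le) force+
  \<comment> \<open>Both mass functions sum to 1.\<close>
  also have "\<dots> = 0"
    using r(2) q(2) by (simp add: sum_subtractf flip: sum_divide_distrib)
  finally show ?thesis
    using le0 by (simp add: * sum_ennreal sum_subtractf sum_negf cong: sum.cong) (simp add: ennreal_leI)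
qed

section \<open>Measures on a finite set and on its product with a second space\<close>

lemma nn_integral_finite_Pow:
  assumes S: "finite S" and K: "sets K = Pow S"
  shows "(\<integral>\<^sup>+ w. f w \<partial>K) = (\<Sum>w\<in>S. emeasure K {w} * f w)"
proof -
  have "K = density (count_space S) (\<lambda>w. emeasure K {w})"
    using S K
    by (intro measure_eqI_finite[of _ S]) (auto simp: emeasure_density nn_integral_count_space_finite indicator_def of_bool_def if_distrib sum.delta cong: if_cong)
  then have "(\<integral>\<^sup>+ w. f w \<partial>K) = (\<integral>\<^sup>+ w. f w \<partial>density (count_space S) (\<lambda>w. emeasure K {w}))"
    by simp
  also have "\<dots> = (\<Sum>w\<in>S. emeasure K {w} * f w)"
    using S by (simp add: nn_integral_density nn_integral_count_space_finite)
  finally show ?thesis .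
qed

lemma nn_integral_count_space_pair:
  assumes S: "finite S" and Y: "sigma_finite_measure Y"
    and f[measurable]: "f \<in> borel_measurable (count_space S \<Otimes>\<^sub>M Y)"
  shows "(\<integral>\<^sup>+ z. f z \<partial>(count_space S \<Otimes>\<^sub>M Y)) = (\<integral>\<^sup>+ y. (\<Sum>w\<in>S. f (w, y)) \<partial>Y)"
proof -
  interpret Y: sigma_finite_measure Y by fact
  have "(\<integral>\<^sup>+ z. f z \<partial>(count_space S \<Otimes>\<^sub>M Y)) = (\<Sum>w\<in>S. \<integral>\<^sup>+ y. f (w, y) \<partial>Y)"
    using S by (subst Y.nn_integral_fst[symmetric]) (auto simp: nn_integral_count_space_finite)
  also have "\<dots> = (\<integral>\<^sup>+ y. (\<Sum>w\<in>S. f (w, y)) \<partial>Y)"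
    by (intro nn_integral_sum[symmetric]) measurable
  finally show ?thesis .
qed

text \<open>As \<open>S\<close> is finite, each measurable set is a finite disjoint union of slices
  \<open>{w} \<times> B\<close>. Agreement on slices therefore gives equality of the measures by
  additivity alone, with no generator argument.\<close>

lemma disintegration_density:
  fixes N :: "'y measure"
  assumes S: "finite S" and J: "prob_space J" "sets J = sets (count_space S \<Otimes>\<^sub>M N)"
    and k[measurable]: "\<And>w. w \<in> S \<Longrightarrow> (\<lambda>y. k w y) \<in> borel_measurable N"
    and eq: "\<And>w B. w \<in> S \<Longrightarrow> B \<in> sets N \<Longrightarrow>
       emeasure J ({w} \<times> B) = (\<integral>\<^sup>+ y\<in>B. k w y \<partial>distr J N snd)"
  shows "J = density (count_space S \<Otimes>\<^sub>M distr J N snd) (\<lambda>(w, y). k w y)"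
proof (rule measure_eqI)
  interpret J: prob_space J by fact
  have [measurable_cong]: "sets J = sets (count_space S \<Otimes>\<^sub>M N)" by fact
  have snd: "snd \<in> J \<rightarrow>\<^sub>M N" by measurable
  interpret Y: prob_space "distr J N snd"
    by (intro J.prob_space_distr snd)
  show "sets J = sets (density (count_space S \<Otimes>\<^sub>M distr J N snd) (\<lambda>(w, y). k w y))"
    unfolding sets_density J(2) by (intro sets_pair_measure_cong) simp_all
  fix E assume "E \<in> sets J"
  then have E[measurable]: "E \<in> sets (count_space S \<Otimes>\<^sub>M N)" using J by simp
  have Ew[measurable]: "Pair w -` E \<in> sets N" for w by measurable
  have [measurable]: "(\<lambda>(w, y). k w y) \<in> borel_measurable (count_space S \<Otimes>\<^sub>M N)"
    using S by (intro measurable_pair_measure_countable1) (auto intro: countable_finite)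
  have "E = (\<Union>w\<in>S. {w} \<times> (Pair w -` E))"
    using sets.sets_into_space[OF E] by (auto simp: space_pair_measure)
  then have "emeasure J E = emeasure J (\<Union>w\<in>S. {w} \<times> (Pair w -` E))" by simp
  also have "\<dots> = (\<Sum>w\<in>S. emeasure J ({w} \<times> (Pair w -` E)))"
    using S by (intro sum_emeasure[symmetric]) (auto simp: disjoint_family_on_def J(2))
  also have "\<dots> = (\<Sum>w\<in>S. \<integral>\<^sup>+ y\<in>Pair w -` E. k w y \<partial>distr J N snd)"
    by (intro sum.cong refl eq Ew)
  also have "\<dots> = (\<integral>\<^sup>+ y. (\<Sum>w\<in>S. k w y * indicator E (w, y)) \<partial>distr J N snd)"
    by (subst nn_integral_sum) (auto intro!: sum.cong nn_integral_cong split: split_indicator)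
  also have "\<dots> = (\<integral>\<^sup>+ z. (\<lambda>(w, y). k w y) z * indicator E z \<partial>(count_space S \<Otimes>\<^sub>M distr J N snd))"
    using S by (subst nn_integral_count_space_pair) (auto intro: Y.sigma_finite_measure_axioms)
  also have "\<dots> = emeasure (density (count_space S \<Otimes>\<^sub>M distr J N snd) (\<lambda>(w, y). k w y)) E"
    by (subst emeasure_density) auto
  finally show "emeasure J E = emeasure (density (count_space S \<Otimes>\<^sub>M distr J N snd) (\<lambda>(w, y). k w y)) E" .
qed


section \<open>Mutual information as entropy minus conditional entropy\<close>

lemma neg_mult_log_le:
  fixes r b :: real
  assumes "b > 1" "0 \<le> r" "r \<le> 1"
  shows "0 \<le> - (r * log b r)" "- (r * log b r) \<le> 1 / ln b"
proof -
  show "0 \<le> - (r * log b r)"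
    using assms by (cases "r = 0") (auto simp: mult_nonneg_nonpos)
  have "- (r * log b r) \<le> (1 - r) / ln b"
    using mult_log_diff_le[of b r 1] assms by simp
  also have "\<dots> \<le> 1 / ln b"
    using assms by (intro divide_right_mono) auto
  finally show "- (r * log b r) \<le> 1 / ln b" .
qed

text \<open>The law \<open>Y\<close> of the signal itself serves as reference measure. Relative to
  \<open>Y\<close> the signal has density 1 and hence entropy 0. Relative to counting measure times
  \<open>Y\<close> the pair has the posterior mass \<open>R\<close> as density, so its entropy is
  the conditional entropy of the sentence. The identity I = H(X) + H(Y) - H(X, Y) then becomes the
  claim.\<close>

lemma mutual_information_disintegration:
  fixes J :: "('s \<times> 'y) measure"
  assumes b: "b > 1" and S: "finite S"
    and J: "prob_space J" "sets J = sets (count_space S \<Otimes>\<^sub>M N)"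
    and K: "K \<in> N \<rightarrow>\<^sub>M prob_algebra (count_space S)"
    and J_eq: "J = density (count_space S \<Otimes>\<^sub>M distr J N snd) (\<lambda>(w, y). emeasure (K y) {w})"
  shows "ereal (prob_space.mutual_information J b (count_space S) N fst snd) =
    ereal (prob_space.entropy J b (count_space S) fst) -
    enn2ereal (\<integral>\<^sup>+ y. (\<Sum>w\<in>S. ennreal (- (measure (K y) {w} * log b (measure (K y) {w})))) \<partial>distr J N snd)"
proof -
  interpret J: information_space J b
    by (intro information_space.intro information_space_axioms.intro J(1) b)
  note [measurable_cong] = J(2)
  define Y where "Y = distr J N snd"
  have snd: "snd \<in> J \<rightarrow>\<^sub>M N" and fst: "fst \<in> J \<rightarrow>\<^sub>M count_space S" by measurable
  interpret Y: prob_space Y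
    unfolding Y_def by (intro J.prob_space_distr snd)
  have sY [measurable_cong]: "sets Y = sets N" by (simp add: Y_def)
  have spY: "space Y = space N" by (simp add: Y_def)
  interpret C: finite_measure "count_space S" by (intro finite_measure_count_space S)
  define D where "D = count_space S \<Otimes>\<^sub>M Y"
  have sD [measurable_cong]: "sets D = sets (count_space S \<Otimes>\<^sub>M N)"
    unfolding D_def by (intro sets_pair_measure_cong) (auto simp: sY)
  have spD: "space D = S \<times> space N" by (simp add: D_def space_pair_measure spY)
  interpret D: finite_measure D
    unfolding D_def by (intro finite_measure_pair_measure C.finite_measure_axioms Y.finite_measure_axioms)
  define R where "R = (\<lambda>z. measure (K (snd z)) {fst z})"
  have Kp: "prob_space (K y)" "sets (K y) = Pow S" if "y \<in> space N" for y
    using measurable_space[OF K that] by (auto simp: space_prob_algebra)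
  have Kw[measurable]: "(\<lambda>y. measure (K y) {w}) \<in> borel_measurable N" if "w \<in> S" for w
    using that measurable_prob_algebraD[OF K] by measurable
  have R[measurable]: "R \<in> borel_measurable (count_space S \<Otimes>\<^sub>M N)"
    using S unfolding R_def split_beta'[symmetric]
    by (intro measurable_pair_measure_countable1) (auto intro: countable_finite)
  have R01: "0 \<le> R z" "R z \<le> 1" if "z \<in> space D" for z
    using Kp[of "snd z"] that unfolding R_def spD
    by (auto intro: prob_space.prob_le_1)
  have emK: "emeasure (K y) {w} = ennreal (R (w, y))" if "y \<in> space N" for w y
    using Kp[OF that] finite_measure.emeasure_eq_measure[OF prob_space.finite_measure]
    by (simp add: R_def)
  have [measurable]: "(\<lambda>(w, y). emeasure (K y) {w}) \<in> borel_measurable (count_space S \<Otimes>\<^sub>M N)"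
    using S measurable_prob_algebraD[OF K]
    by (intro measurable_pair_measure_countable1) (auto intro: countable_finite)
  have "J = density D R"
    by (subst J_eq, unfold Y_def[symmetric] D_def[symmetric], intro density_cong)
       (auto simp: emK spD)
  moreover have id: "distr J D (\<lambda>x. (fst x, snd x)) = J"
    using distr_id2[of D J] sD J(2) by simp
  ultimately have Pxy: "distributed J (count_space S \<Otimes>\<^sub>M Y) (\<lambda>x. (fst x, snd x)) R"
    unfolding distributed_def D_def[symmetric] by (auto intro!: measurable_ident_sets simp: sD J(2))
  have Y1: "distr J Y snd = Y"
    unfolding Y_def by (intro distr_cong) auto
  then have Py: "distributed J Y snd (\<lambda>_. ennreal 1)"
    unfolding distributed_def by (simp add: density_1)
  define p where "p w = measure J (fst -` {w} \<inter> space J)" for w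
  have "distr J (count_space S) fst = density (count_space S) (\<lambda>w. ennreal (p w))"
    using S by (intro measure_eqI_finite[of _ S])
      (auto simp: emeasure_density nn_integral_count_space_finite indicator_def of_bool_def if_distrib
        sum.delta emeasure_distr[OF fst] J.emeasure_eq_measure p_def cong: if_cong)
  then have Px: "distributed J (count_space S) fst (\<lambda>w. ennreal (p w))"
    unfolding distributed_def using fst by simp
  have [measurable]: "(\<lambda>z. p (fst z)) \<in> borel_measurable (count_space S \<Otimes>\<^sub>M N)"
    by (rule measurable_compose[OF measurable_fst]) simp
  have Ix: "integrable (count_space S \<Otimes>\<^sub>M Y) (\<lambda>x. R x * log b (p (fst x)))"
    unfolding D_def[symmetric]
  proof (rule D.integrable_const_bound)
    \<comment> \<open>One constant must serve for all sentences, and the sum over the finite set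
      \<open>S\<close> dominates each of its terms. A prior mass of 0 does no harm, since
      \<open>log b 0 = 0\<close>.\<close>
    have "norm (R z * log b (p (fst z))) \<le> (\<Sum>w\<in>S. \<bar>log b (p w)\<bar>)" if "z \<in> space D" for z
    proof -
      have "norm (R z * log b (p (fst z))) \<le> 1 * \<bar>log b (p (fst z))\<bar>"
        using R01[OF that] mult_right_mono[of "R z" 1 "\<bar>log b (p (fst z))\<bar>"] by (simp add: abs_mult)
      also have "\<dots> \<le> (\<Sum>w\<in>S. \<bar>log b (p w)\<bar>)"
        using S that member_le_sum[of "fst z" S "\<lambda>w. \<bar>log b (p w)\<bar>"] by (auto simp: spD)
      finally show ?thesis .
    qed
    then show "AE z in D. norm (R z * log b (p (fst z))) \<le> (\<Sum>w\<in>S. \<bar>log b (p w)\<bar>)" by simp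
  qed measurable
  have Iy: "integrable (count_space S \<Otimes>\<^sub>M Y) (\<lambda>x. R x * log b 1)" by simp
  have Ixy: "integrable (count_space S \<Otimes>\<^sub>M Y) (\<lambda>x. R x * log b (R x))"
    unfolding D_def[symmetric]
  proof (rule D.integrable_const_bound)
    \<comment> \<open>\<open>D\<close> is a finite measure, so a uniform bound gives integrability.
      The constant \<open>1 / ln b\<close> comes from \<open>mult_log_diff_le\<close> with
      \<open>q = 1\<close>.\<close>
    show "AE z in D. norm (R z * log b (R z)) \<le> 1 / ln b"
    proof (rule AE_I2)
      show "norm (R z * log b (R z)) \<le> 1 / ln b" if "z \<in> space D" for z
        using neg_mult_log_le[OF b R01[OF that]] by (simp add: abs_of_nonpos)
    qed
  qed measurable
  \<comment> \<open>Mutual information sees only the measurable structure of the target spaces.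
    Hence \<open>N\<close> may be exchanged for \<open>Y\<close>, whose measure is the one that the
    densities refer to.\<close>
  have "J.mutual_information b (count_space S) N fst snd = J.mutual_information b (count_space S) Y fst snd"
    unfolding J.mutual_information_def Y1
    by (simp add: Y_def[symmetric]) (intro arg_cong2[where f="KL_divergence b"] refl distr_cong, auto simp: sD[unfolded D_def])
  also have "\<dots> = J.entropy b (count_space S) fst + J.entropy b Y snd - J.entropy b (count_space S \<Otimes>\<^sub>M Y) (\<lambda>x. (fst x, snd x))"
    using J.mutual_information_eq_entropy_conditional_entropy_distr[OF C.sigma_finite_measure_axioms Y.sigma_finite_measure_axioms
        Px _ Py _ Pxy _ Ix Iy Ixy] R01
    by (simp add: p_def spD spY)
  also have "J.entropy b Y snd = 0"
    using J.entropy_distr[OF Py] by simp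
  also have "J.entropy b (count_space S \<Otimes>\<^sub>M Y) (\<lambda>x. (fst x, snd x)) = (\<integral>z. - (R z * log b (R z)) \<partial>D)"
    using J.entropy_distr[OF Pxy] R01 by (simp add: D_def)
  finally have mi: "J.mutual_information b (count_space S) N fst snd =
    J.entropy b (count_space S) fst - (\<integral>z. - (R z * log b (R z)) \<partial>D)" by simp
  have nonneg: "0 \<le> (\<integral>z. - (R z * log b (R z)) \<partial>D)"
    using neg_mult_log_le(1)[OF b R01] by (intro Bochner_Integration.integral_nonneg) auto
  have "ennreal (\<integral>z. - (R z * log b (R z)) \<partial>D) = (\<integral>\<^sup>+ z. ennreal (- (R z * log b (R z))) \<partial>D)"
    using Ixy neg_mult_log_le(1)[OF b R01] unfolding D_def[symmetric]
    by (intro nn_integral_eq_integral[symmetric]) auto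
  also have "\<dots> = (\<integral>\<^sup>+ y. (\<Sum>w\<in>S. ennreal (- (R (w, y) * log b (R (w, y))))) \<partial>Y)"
    unfolding D_def by (intro nn_integral_count_space_pair S Y.sigma_finite_measure_axioms) measurable
  finally have "enn2ereal (\<integral>\<^sup>+ y. (\<Sum>w\<in>S. ennreal (- (R (w, y) * log b (R (w, y))))) \<partial>Y) =
     ereal (\<integral>z. - (R z * log b (R z)) \<partial>D)"
    using nonneg by (metis enn2ereal_ennreal)
  then show ?thesis
    unfolding mi Y_def[symmetric] by (simp add: R_def)
qed


section \<open>The decoder bound for a single joint law\<close>

lemma ereal_expectation_cong:
  assumes "\<And>x. x \<in> space M \<Longrightarrow> f x = g x"
  shows "ereal_expectation M f = ereal_expectation M g"
  unfolding ereal_expectation_def using assms by (simp cong: nn_integral_cong)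

text \<open>Integrating the negated logarithm first over sentences with weights from
  \<open>K y\<close>, then over \<open>y\<close>, turns the expectation under \<open>J\<close> into
  minus the average cross entropy; this is the equation. For the inequality, the same average is
  compared with the conditional entropy of \<open>mutual_information_disintegration\<close>, using
  \<open>gibbs_ennreal\<close> at each \<open>y\<close>.\<close>

lemma decoder_lower_bound:
  fixes J :: "('s \<times> 'y) measure"
  assumes b: "b > 1" and S: "finite S"
    and J: "prob_space J" "sets J = sets (count_space S \<Otimes>\<^sub>M N)"
    and K: "K \<in> N \<rightarrow>\<^sub>M prob_algebra (count_space S)"
    and J_eq: "J = density (count_space S \<Otimes>\<^sub>M distr J N snd) (\<lambda>(w, y). emeasure (K y) {w})"
    and q: "\<And>w. w \<in> S \<Longrightarrow> q w \<in> borel_measurable N"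
      "\<And>w y. w \<in> S \<Longrightarrow> y \<in> space N \<Longrightarrow> 0 \<le> q w y"
      "\<And>y. y \<in> space N \<Longrightarrow> (\<Sum>w\<in>S. q w y) = 1"
  shows "ereal (prob_space.entropy J b (count_space S) fst) + ereal_expectation J (\<lambda>(w, y). elog b (q w y))
      \<le> ereal (prob_space.mutual_information J b (count_space S) N fst snd)" (is ?ineq)
    and "ereal_expectation J (\<lambda>(w, y). elog b (q w y)) =
      - ereal_expectation (distr J N snd) (\<lambda>y. - ereal_expectation (K y) (\<lambda>w. elog b (q w y)))" (is ?eq)
proof -
  interpret J: prob_space J by fact
  note [measurable_cong] = J(2)
  note [measurable] = q(1)
  define Y where "Y = distr J N snd"
  have snd: "snd \<in> J \<rightarrow>\<^sub>M N" by measurable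
  interpret Y: prob_space Y
    unfolding Y_def by (intro J.prob_space_distr snd)
  have sY [measurable_cong]: "sets Y = sets N" by (simp add: Y_def)
  have spY: "space Y = space N" by (simp add: Y_def)
  have spJ: "space J = S \<times> space N"
    using sets_eq_imp_space_eq[OF J(2)] by (simp add: space_pair_measure)
  have Kp: "prob_space (K y)" "sets (K y) = Pow S" if "y \<in> space N" for y
    using measurable_space[OF K that] by (auto simp: space_prob_algebra)
  have spK: "space (K y) = S" if "y \<in> space N" for y
    using sets_eq_imp_space_eq[of "K y" "count_space S"] Kp[OF that] by simp
  have emK: "emeasure (K y) {w} = ennreal (measure (K y) {w})" if "y \<in> space N" for w y
    using finite_measure.emeasure_eq_measure[OF prob_space.finite_measure[OF Kp(1)[OF that]]] .
  have sum_K: "(\<Sum>w\<in>S. measure (K y) {w}) = 1" if "y \<in> space N" for y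
  proof -
    interpret Ky: prob_space "K y" by (rule Kp[OF that])
    show ?thesis
      using S Ky.prob_space Ky.finite_measure_eq_sum_singleton[of S] Kp[OF that]
      by (simp add: spK[OF that])
  qed
  have q1: "q w y \<le> 1" if "w \<in> S" "y \<in> space N" for w y
    using member_le_sum[of w S "\<lambda>w. q w y"] S q(2,3) that by auto
  have el0: "elog b (q w y) \<le> 0" if "w \<in> S" "y \<in> space N" for w y
    using elog_nonpos[OF b] q(2) q1 that by auto
  \<comment> \<open>Negation comes before the passage to \<open>ennreal\<close>, so nothing is
    truncated: on the relevant domain \<open>- elog\<close> is nonnegative, and it becomes
    \<open>top\<close> where \<open>q\<close> vanishes.\<close>
  define F where "F = (\<lambda>(w, y). e2ennreal (- elog b (q w y)))"
  have F[measurable]: "F \<in> borel_measurable (count_space S \<Otimes>\<^sub>M N)"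
    unfolding F_def using S
    by (intro measurable_pair_measure_countable1) (auto intro: countable_finite)
  have [measurable]: "(\<lambda>(w, y). emeasure (K y) {w}) \<in> borel_measurable (count_space S \<Otimes>\<^sub>M N)"
    using S measurable_prob_algebraD[OF K]
    by (intro measurable_pair_measure_countable1) (auto intro: countable_finite)
  have "(\<integral>\<^sup>+ z. F z \<partial>J) = (\<integral>\<^sup>+ z. (\<lambda>(w, y). emeasure (K y) {w}) z * F z \<partial>(count_space S \<Otimes>\<^sub>M Y))"
    by (subst J_eq, unfold Y_def[symmetric], subst nn_integral_density) auto
  also have "\<dots> = (\<integral>\<^sup>+ y. (\<Sum>w\<in>S. emeasure (K y) {w} * F (w, y)) \<partial>Y)"
    by (subst nn_integral_count_space_pair[OF S Y.sigma_finite_measure_axioms]) auto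
  finally have int_F: "(\<integral>\<^sup>+ z. F z \<partial>J) = (\<integral>\<^sup>+ y. (\<Sum>w\<in>S. emeasure (K y) {w} * F (w, y)) \<partial>Y)" .
  have "ereal_expectation J (\<lambda>(w, y). elog b (q w y)) = - enn2ereal (\<integral>\<^sup>+ z. F z \<partial>J)"
    using el0 by (subst ereal_expectation_nonpos) (auto simp: spJ F_def split_beta')
  note E = this[unfolded int_F]
  have "- ereal_expectation (K y) (\<lambda>w. elog b (q w y)) = enn2ereal (\<Sum>w\<in>S. emeasure (K y) {w} * F (w, y))"
    if "y \<in> space Y" for y
  proof -
    have y: "y \<in> space N" using that by (simp add: spY)
    show ?thesis
      using el0 y by (subst ereal_expectation_nonpos) (auto simp: spK nn_integral_finite_Pow[OF S Kp(2)] F_def)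
  qed
  then have "ereal_expectation Y (\<lambda>y. - ereal_expectation (K y) (\<lambda>w. elog b (q w y))) =
      enn2ereal (\<integral>\<^sup>+ y. (\<Sum>w\<in>S. emeasure (K y) {w} * F (w, y)) \<partial>Y)"
    by (subst ereal_expectation_enn2ereal[symmetric]) (rule ereal_expectation_cong)
  then show ?eq
    unfolding Y_def[symmetric] E by simp
  have "(\<integral>\<^sup>+ y. (\<Sum>w\<in>S. ennreal (- (measure (K y) {w} * log b (measure (K y) {w})))) \<partial>Y)
      \<le> (\<integral>\<^sup>+ y. (\<Sum>w\<in>S. emeasure (K y) {w} * F (w, y)) \<partial>Y)"
    using gibbs_ennreal[OF b S _ sum_K _ q(3)] q(2)
    by (intro nn_integral_mono) (simp add: spY emK F_def)
  then show ?ineq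
    unfolding mutual_information_disintegration[OF b S J K J_eq] Y_def[symmetric] E minus_ereal_def
    by (intro add_left_mono) (simp add: less_eq_ennreal.rep_eq)
qed

section \<open>Disintegration for almost every channel value\<close>

lemma countable_Int_stable_borel_generator:
  obtains G :: "'y::second_countable_topology set set"
  where "countable G" "Int_stable G" "UNIV \<in> G" "sets borel = sigma_sets UNIV G"
proof -
  obtain B :: "'y set set" where B: "countable B" "topological_basis B"
    using ex_countable_basis by auto
  \<comment> \<open>Finite intersections make a countable basis stable under intersection and keep
    it countable; the empty intersection supplies \<open>UNIV\<close>.\<close>
  define G where "G = Inter ` {F. finite F \<and> F \<subseteq> B}"
  have "countable G"
    unfolding G_def using B by (intro countable_image countable_Collect_finite_subset)
  moreover have "Int_stable G"
    unfolding Int_stable_def G_def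
  proof safe
    fix F1 F2 assume "finite F1" "F1 \<subseteq> B" "finite F2" "F2 \<subseteq> B"
    then show "\<Inter>F1 \<inter> \<Inter>F2 \<in> Inter ` {F. finite F \<and> F \<subseteq> B}"
      by (intro image_eqI[of _ _ "F1 \<union> F2"]) auto
  qed
  moreover have "UNIV \<in> G"
    unfolding G_def by (intro image_eqI[of _ _ "{}"]) auto
  moreover have "sets borel = sigma_sets UNIV G"
  proof -
    have "sets borel = sigma_sets UNIV B"
      by (subst borel_eq_countable_basis[OF B]) simp
    also have "\<dots> = sigma_sets UNIV G"
    proof (rule sigma_sets_eqI)
      show "X \<in> sigma_sets UNIV G" if "X \<in> B" for X
        using that unfolding G_def by (intro sigma_sets.Basic image_eqI[of _ _ "{X}"]) auto
      show "X \<in> sigma_sets UNIV B" if "X \<in> G" for X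
      proof -
        from that obtain F where F: "finite F" "F \<subseteq> B" "X = \<Inter>F" by (auto simp: G_def)
        then have "open X"
          using topological_basis_open[OF B(2)] by (auto intro: open_Inter)
        then show ?thesis
          using \<open>sets borel = sigma_sets UNIV B\<close> borel_open by blast
      qed
    qed
    finally show ?thesis .
  qed
  ultimately show ?thesis by (rule that)
qed

text \<open>Both almost-sure identities in the channel value below are obtained this way, by
  comparing averages over all channel events. It rests on the uniqueness of densities over a
  sigma-finite measure.\<close>

lemma AE_eq_of_set_nn_integral_eq:
  assumes M: "sigma_finite_measure M"
    and [measurable]: "f \<in> borel_measurable M" "g \<in> borel_measurable M"
    and eq: "\<And>A. A \<in> sets M \<Longrightarrow> (\<integral>\<^sup>+ x\<in>A. f x \<partial>M) = (\<integral>\<^sup>+ x\<in>A. g x \<partial>M)"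
  shows "AE x in M. f x = g x"
proof -
  interpret sigma_finite_measure M by fact
  have "density M f = density M g"
    using eq by (intro measure_eqI) (simp_all add: emeasure_density)
  then show ?thesis
    by (intro density_unique_iff[THEN iffD1]) auto
qed

lemma regular_cond_distr_kernel:
  assumes "regular_cond_distr M A X B Y K" "y \<in> space B"
  shows "prob_space (K y)" "sets (K y) = sets A"
  using assms measurable_space[of K B "prob_algebra A" y]
  by (auto simp: regular_cond_distr_def space_prob_algebra)

text \<open>The posterior is defined through the law of the pair (signal, channel), whereas the
  joint kernel \<open>J\<close> fixes the channel value. This links the two: the law of the pair is
  a mixture over \<open>h\<close> of signal laws, which is checked on rectangles, and integrals
  against a mixture are iterated integrals.\<close>

lemma nn_integral_regular_cond_distr:
  assumes M: "prob_space M"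
    and J: "regular_cond_distr M (A \<Otimes>\<^sub>M N) (\<lambda>\<omega>. (X \<omega>, Y \<omega>)) B H J"
    and f[measurable]: "f \<in> borel_measurable (N \<Otimes>\<^sub>M B)"
  shows "(\<integral>\<^sup>+ \<omega>. f (Y \<omega>, H \<omega>) \<partial>M) = (\<integral>\<^sup>+ h. (\<integral>\<^sup>+ y. f (y, h) \<partial>distr (J h) N snd) \<partial>distr M B H)"
proof -
  interpret prob_space M by fact
  have XY: "(\<lambda>\<omega>. (X \<omega>, Y \<omega>)) \<in> M \<rightarrow>\<^sub>M A \<Otimes>\<^sub>M N" and H[measurable]: "H \<in> M \<rightarrow>\<^sub>M B"
    and Jm: "J \<in> B \<rightarrow>\<^sub>M prob_algebra (A \<Otimes>\<^sub>M N)"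
    and J_rect: "\<And>S T. S \<in> sets (A \<Otimes>\<^sub>M N) \<Longrightarrow> T \<in> sets B \<Longrightarrow>
      emeasure M {\<omega> \<in> space M. (X \<omega>, Y \<omega>) \<in> S \<and> H \<omega> \<in> T} = (\<integral>\<^sup>+ h\<in>T. emeasure (J h) S \<partial>distr M B H)"
    using J by (auto simp: regular_cond_distr_def)
  have XYs: "X \<omega> \<in> space A" if "\<omega> \<in> space M" for \<omega>
    using measurable_space[OF XY that] by (simp add: space_pair_measure)
  have Y[measurable]: "Y \<in> M \<rightarrow>\<^sub>M N"
    using measurable_compose[OF XY measurable_snd] by simp
  note Js = regular_cond_distr_kernel[OF J]
  \<comment> \<open>The signal law at \<open>h\<close>, with the point \<open>h\<close> attached as
    second coordinate, so that mixing over \<open>h\<close> yields a measure on pairs.\<close>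
  define \<mu> where "\<mu> = (\<lambda>h. distr (J h) (N \<Otimes>\<^sub>M B) (\<lambda>z. (snd z, h)))"
  have \<mu>: "\<mu> \<in> B \<rightarrow>\<^sub>M prob_algebra (N \<Otimes>\<^sub>M B)"
    unfolding \<mu>_def by (rule measurable_distr_prob_space2[OF Jm]) measurable
  interpret PH: prob_space "distr M B H"
    by (intro prob_space_distr H)
  have PH: "distr M B H \<in> space (prob_algebra B)"
    by (simp add: space_prob_algebra PH.prob_space_axioms)
  have bind_eq: "distr M (N \<Otimes>\<^sub>M B) (\<lambda>\<omega>. (Y \<omega>, H \<omega>)) = distr M B H \<bind> \<mu>" (is "?L = ?R")
  proof (rule measure_eqI_generator_eq[OF Int_stable_pair_measure_generator[of N B]])
    have R: "sets ?R = sets (N \<Otimes>\<^sub>M B)"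
      by (rule sets_bind'[OF PH \<mu>])
    show "sets ?L = sigma_sets (space N \<times> space B) {a \<times> b |a b. a \<in> sets N \<and> b \<in> sets B}"
      "sets ?R = sigma_sets (space N \<times> space B) {a \<times> b |a b. a \<in> sets N \<and> b \<in> sets B}"
      by (simp_all add: R sets_pair_measure)
    show "{a \<times> b |a b. a \<in> sets N \<and> b \<in> sets B} \<subseteq> Pow (space N \<times> space B)"
      using sets.space_closed[of N] sets.space_closed[of B] by auto
    show "range (\<lambda>_::nat. space N \<times> space B) \<subseteq> {a \<times> b |a b. a \<in> sets N \<and> b \<in> sets B}"
      by auto
    show "(\<Union>i::nat. space N \<times> space B) = space N \<times> space B" by simp
    interpret L: prob_space ?L
      by (intro prob_space_distr) measurable
    show "emeasure ?L (space N \<times> space B) \<noteq> \<infinity>" by simp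
    fix E assume "E \<in> {a \<times> b |a b. a \<in> sets N \<and> b \<in> sets B}"
    then obtain S T where E: "E = S \<times> T" and S[measurable]: "S \<in> sets N" and T[measurable]: "T \<in> sets B" by auto
    have "emeasure ?L E = emeasure M {\<omega> \<in> space M. (X \<omega>, Y \<omega>) \<in> space A \<times> S \<and> H \<omega> \<in> T}"
      unfolding E using XYs by (subst emeasure_distr) (auto intro!: arg_cong[where f="emeasure M"])
    also have "\<dots> = (\<integral>\<^sup>+ h\<in>T. emeasure (J h) (space A \<times> S) \<partial>distr M B H)"
      by (intro J_rect) auto
    also have "\<dots> = (\<integral>\<^sup>+ h. emeasure (\<mu> h) E \<partial>distr M B H)"
    proof (intro nn_integral_cong)
      fix h assume "h \<in> space (distr M B H)"
      then have h: "h \<in> space B" by simp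
      have sp: "space (J h) = space A \<times> space N"
        using sets_eq_imp_space_eq[OF Js(2)[OF h]] by (simp add: space_pair_measure)
      have "(\<lambda>z. (snd z, h)) \<in> A \<Otimes>\<^sub>M N \<rightarrow>\<^sub>M N \<Otimes>\<^sub>M B" using h by measurable
      then have "(\<lambda>z. (snd z, h)) \<in> J h \<rightarrow>\<^sub>M N \<Otimes>\<^sub>M B"
        by (simp cong: measurable_cong_sets add: Js(2)[OF h])
      then have "emeasure (\<mu> h) E = emeasure (J h) ((\<lambda>z. (snd z, h)) -` E \<inter> space (J h))"
        unfolding \<mu>_def E by (intro emeasure_distr) auto
      \<comment> \<open>With the channel value fixed, a rectangle contributes a full strip over
        \<open>S\<close> or nothing. The factor \<open>space A\<close> leaves the sentence
        unconstrained.\<close>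
      also have "(\<lambda>z. (snd z, h)) -` E \<inter> space (J h) = (if h \<in> T then space A \<times> S else {})"
        using sets.sets_into_space[OF S] by (auto simp: E sp)
      finally show "emeasure (J h) (space A \<times> S) * indicator T h = emeasure (\<mu> h) E"
        by simp
    qed
    also have "\<dots> = emeasure ?R E"
      by (subst emeasure_bind_prob_algebra[OF PH \<mu>]) (auto simp: E)
    finally show "emeasure ?L E = emeasure ?R E" .
  qed
  have "(\<integral>\<^sup>+ \<omega>. f (Y \<omega>, H \<omega>) \<partial>M) = (\<integral>\<^sup>+ z. f z \<partial>distr M (N \<Otimes>\<^sub>M B) (\<lambda>\<omega>. (Y \<omega>, H \<omega>)))"
    by (subst nn_integral_distr) auto
  also have "\<dots> = (\<integral>\<^sup>+ z. f z \<partial>(distr M B H \<bind> \<mu>))"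
    by (simp only: bind_eq)
  also have "\<dots> = (\<integral>\<^sup>+ h. (\<integral>\<^sup>+ z. f z \<partial>\<mu> h) \<partial>distr M B H)"
    using measurable_prob_algebraD[OF \<mu>] by (intro nn_integral_bind[where B="N \<Otimes>\<^sub>M B"]) simp_all
  also have "\<dots> = (\<integral>\<^sup>+ h. (\<integral>\<^sup>+ y. f (y, h) \<partial>distr (J h) N snd) \<partial>distr M B H)"
  proof (intro nn_integral_cong)
    fix h assume "h \<in> space (distr M B H)"
    then have h[measurable]: "h \<in> space B" by simp
    note [measurable_cong] = Js(2)[OF h]
    show "(\<integral>\<^sup>+ z. f z \<partial>\<mu> h) = (\<integral>\<^sup>+ y. f (y, h) \<partial>distr (J h) N snd)"
      unfolding \<mu>_def by (simp add: nn_integral_distr)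
  qed
  finally show ?thesis .
qed

text \<open>For fixed \<open>w\<close> and \<open>A\<close> the identity holds for almost all \<open>h\<close>; the null set is made independent
  of \<open>A\<close> by restricting \<open>A\<close> to a countable generator closed under intersection.\<close>

lemma AE_disintegration:
  fixes Y :: "'w \<Rightarrow> 'y::second_countable_topology"
  assumes M: "prob_space M" and S: "finite S"
    and J: "regular_cond_distr M (count_space S \<Otimes>\<^sub>M borel) (\<lambda>\<omega>. (X \<omega>, Y \<omega>)) B H J"
    and K: "regular_cond_distr M (count_space S) X (borel \<Otimes>\<^sub>M B) (\<lambda>\<omega>. (Y \<omega>, H \<omega>)) K"
  shows "AE h in distr M B H. \<forall>w\<in>S. \<forall>A\<in>sets borel.
    emeasure (J h) ({w} \<times> A) = (\<integral>\<^sup>+ y\<in>A. emeasure (K (y, h)) {w} \<partial>distr (J h) borel snd)"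
proof -
  interpret prob_space M by fact
  have XY: "(\<lambda>\<omega>. (X \<omega>, Y \<omega>)) \<in> M \<rightarrow>\<^sub>M count_space S \<Otimes>\<^sub>M borel" and H[measurable]: "H \<in> M \<rightarrow>\<^sub>M B"
    and Jm: "J \<in> B \<rightarrow>\<^sub>M prob_algebra (count_space S \<Otimes>\<^sub>M borel)"
    and J_rect: "\<And>E T. E \<in> sets (count_space S \<Otimes>\<^sub>M borel) \<Longrightarrow> T \<in> sets B \<Longrightarrow>
      emeasure M {\<omega> \<in> space M. (X \<omega>, Y \<omega>) \<in> E \<and> H \<omega> \<in> T} = (\<integral>\<^sup>+ h\<in>T. emeasure (J h) E \<partial>distr M B H)"
    using J by (auto simp: regular_cond_distr_def)
  have Km: "K \<in> borel \<Otimes>\<^sub>M B \<rightarrow>\<^sub>M prob_algebra (count_space S)"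
    and K_rect: "\<And>E T. E \<in> sets (count_space S) \<Longrightarrow> T \<in> sets (borel \<Otimes>\<^sub>M B) \<Longrightarrow>
      emeasure M {\<omega> \<in> space M. X \<omega> \<in> E \<and> (Y \<omega>, H \<omega>) \<in> T} =
      (\<integral>\<^sup>+ z\<in>T. emeasure (K z) E \<partial>distr M (borel \<Otimes>\<^sub>M B) (\<lambda>\<omega>. (Y \<omega>, H \<omega>)))"
    using K by (auto simp: regular_cond_distr_def)
  have Y[measurable]: "Y \<in> M \<rightarrow>\<^sub>M borel"
    using measurable_compose[OF XY measurable_snd] by simp
  note Js = regular_cond_distr_kernel[OF J]
  note Jsub = measurable_prob_algebraD[OF Jm]
  have Kmeas: "(\<lambda>z. emeasure (K z) {w}) \<in> borel_measurable (borel \<Otimes>\<^sub>M B)" if "w \<in> S" for w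
    using that measurable_prob_algebraD[OF Km] by measurable
  interpret PH: prob_space "distr M B H"
    by (intro prob_space_distr H)
  \<comment> \<open>Averaged over any channel event \<open>T\<close>, both sides equal the
    probability that \<open>X = w\<close>, \<open>Y\<close> lies in \<open>A\<close> and
    \<open>H\<close> lies in \<open>T\<close>: one side evaluates it by \<open>J\<close>, the other
    by \<open>K\<close> and the mixture formula.\<close>
  have step: "AE h in distr M B H.
      emeasure (J h) ({w} \<times> A) = (\<integral>\<^sup>+ y\<in>A. emeasure (K (y, h)) {w} \<partial>distr (J h) borel snd)"
    if w: "w \<in> S" and A[measurable]: "A \<in> sets borel" for w A
  proof (rule AE_eq_of_set_nn_integral_eq[OF PH.sigma_finite_measure_axioms])
    note [measurable] = Kmeas[OF w]
    have wA[measurable]: "{w} \<times> A \<in> sets (count_space S \<Otimes>\<^sub>M borel)"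
      using w by auto
    show "(\<lambda>h. emeasure (J h) ({w} \<times> A)) \<in> borel_measurable (distr M B H)"
      using Jsub by measurable
    \<comment> \<open>The signal law is again a kernel in \<open>h\<close>; this is what makes the
      integral against it measurable in \<open>h\<close>.\<close>
    have Jsnd: "(\<lambda>h. distr (J h) borel snd) \<in> B \<rightarrow>\<^sub>M subprob_algebra borel"
      using measurable_compose[OF Jsub measurable_distr[of snd _ borel]] by simp
    show "(\<lambda>h. \<integral>\<^sup>+ y\<in>A. emeasure (K (y, h)) {w} \<partial>distr (J h) borel snd) \<in> borel_measurable (distr M B H)"
      using nn_integral_measurable_subprob_algebra2[OF _ Jsnd,
        of "\<lambda>h y. emeasure (K (y, h)) {w} * indicator A y"] by simp
    fix T assume "T \<in> sets (distr M B H)"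
    then have T[measurable]: "T \<in> sets B" by simp
    have "(\<integral>\<^sup>+ h\<in>T. emeasure (J h) ({w} \<times> A) \<partial>distr M B H) =
        emeasure M {\<omega> \<in> space M. (X \<omega>, Y \<omega>) \<in> {w} \<times> A \<and> H \<omega> \<in> T}"
      by (intro J_rect[symmetric] wA T)
    also have "\<dots> = emeasure M {\<omega> \<in> space M. X \<omega> \<in> {w} \<and> (Y \<omega>, H \<omega>) \<in> A \<times> T}"
      by (intro arg_cong[where f="emeasure M"]) auto
    also have "\<dots> = (\<integral>\<^sup>+ z\<in>A \<times> T. emeasure (K z) {w} \<partial>distr M (borel \<Otimes>\<^sub>M B) (\<lambda>\<omega>. (Y \<omega>, H \<omega>)))"
      using w by (intro K_rect) auto
    also have "\<dots> = (\<integral>\<^sup>+ \<omega>. emeasure (K (Y \<omega>, H \<omega>)) {w} * indicator (A \<times> T) (Y \<omega>, H \<omega>) \<partial>M)"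
      by (subst nn_integral_distr) auto
    also have "\<dots> = (\<integral>\<^sup>+ h. (\<integral>\<^sup>+ y. emeasure (K (y, h)) {w} * indicator (A \<times> T) (y, h) \<partial>distr (J h) borel snd) \<partial>distr M B H)"
      by (intro nn_integral_regular_cond_distr[OF M J, where f="\<lambda>z. emeasure (K z) {w} * indicator (A \<times> T) z"]) measurable
    also have "\<dots> = (\<integral>\<^sup>+ h\<in>T. (\<integral>\<^sup>+ y\<in>A. emeasure (K (y, h)) {w} \<partial>distr (J h) borel snd) \<partial>distr M B H)"
      by (intro nn_integral_cong) (auto simp: indicator_times split: split_indicator)
    finally show "(\<integral>\<^sup>+ h\<in>T. emeasure (J h) ({w} \<times> A) \<partial>distr M B H) =
      (\<integral>\<^sup>+ h\<in>T. (\<integral>\<^sup>+ y\<in>A. emeasure (K (y, h)) {w} \<partial>distr (J h) borel snd) \<partial>distr M B H)" .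
  qed
  obtain G :: "'y set set" where G: "countable G" "Int_stable G" "UNIV \<in> G" "sets borel = sigma_sets UNIV G"
    by (rule countable_Int_stable_borel_generator)
  have G_sets: "A \<in> sets borel" if "A \<in> G" for A
    unfolding G(4) using that by (rule sigma_sets.Basic)
  have "AE h in distr M B H. \<forall>w\<in>S. \<forall>A\<in>G.
      emeasure (J h) ({w} \<times> A) = (\<integral>\<^sup>+ y\<in>A. emeasure (K (y, h)) {w} \<partial>distr (J h) borel snd)"
    by (intro AE_finite_allI[OF S] AE_ball_countable'[OF _ G(1)] step G_sets)
  then show ?thesis
    using AE_space
  proof (eventually_elim, intro ballI)
    fix h w and A :: "'y set"
    assume eqG: "\<forall>w\<in>S. \<forall>A\<in>G. emeasure (J h) ({w} \<times> A) = (\<integral>\<^sup>+ y\<in>A. emeasure (K (y, h)) {w} \<partial>distr (J h) borel snd)"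
      and "h \<in> space (distr M B H)" and w: "w \<in> S" and A: "A \<in> sets borel"
    then have h[measurable]: "h \<in> space B" by simp
    note [measurable_cong] = Js(2)[OF h]
    interpret Jh: prob_space "J h" by (rule Js(1)[OF h])
    have spJ: "space (J h) = S \<times> UNIV"
      using sets_eq_imp_space_eq[OF Js(2)[OF h]] by (simp add: space_pair_measure)
    have wU[measurable]: "{w} \<times> UNIV \<in> sets (count_space S \<Otimes>\<^sub>M borel)" using w by auto
    note [measurable] = Kmeas[OF w]
    \<comment> \<open>Each side of the identity, as a function of the set \<open>A\<close>, is
      realized as a measure: restriction to the fibre over \<open>w\<close> pushed to the signal,
      and a density over the signal law. Measures that agree on \<open>G\<close> are equal.\<close>
    define \<mu> where "\<mu> = distr (density (J h) (indicator ({w} \<times> UNIV))) (borel :: 'y measure) snd"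
    define \<nu> where "\<nu> = density (distr (J h) borel snd) (\<lambda>y. emeasure (K (y, h)) {w})"
    have \<mu>: "emeasure \<mu> E = emeasure (J h) ({w} \<times> E)" if "E \<in> sets borel" for E
    proof -
      have E[measurable]: "E \<in> sets borel" by fact
      have "emeasure \<mu> E = (\<integral>\<^sup>+ z. indicator ({w} \<times> UNIV) z * indicator (snd -` E \<inter> space (J h)) z \<partial>J h)"
        unfolding \<mu>_def by (simp add: emeasure_distr emeasure_density)
      also have "\<dots> = (\<integral>\<^sup>+ z. indicator ({w} \<times> E) z \<partial>J h)"
        by (intro nn_integral_cong) (auto simp: spJ split: split_indicator)
      also have "\<dots> = emeasure (J h) ({w} \<times> E)"
        using w E by (intro nn_integral_indicator) (auto simp: Js(2)[OF h])
      finally show ?thesis .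
    qed
    have \<nu>: "emeasure \<nu> E = (\<integral>\<^sup>+ y\<in>E. emeasure (K (y, h)) {w} \<partial>distr (J h) borel snd)" if "E \<in> sets borel" for E
      unfolding \<nu>_def using that by (subst emeasure_density) auto
    have "\<mu> = \<nu>"
    proof (rule measure_eqI_generator_eq[OF G(2)])
      show "emeasure \<mu> E = emeasure \<nu> E" if "E \<in> G" for E
        using eqG w that G_sets[OF that] by (simp add: \<mu> \<nu>)
      show "sets \<mu> = sigma_sets UNIV G" "sets \<nu> = sigma_sets UNIV G"
        by (simp_all add: \<mu>_def \<nu>_def G(4))
      show "range (\<lambda>_::nat. UNIV) \<subseteq> G" using G(3) by auto
    qed (auto simp: \<mu>)
    then show "emeasure (J h) ({w} \<times> A) = (\<integral>\<^sup>+ y\<in>A. emeasure (K (y, h)) {w} \<partial>distr (J h) borel snd)"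
      using \<mu>[OF A] \<nu>[OF A] by simp
  qed
qed

section \<open>Independence of the source and the channel\<close>

lemma indep_vars3_emeasure:
  assumes M: "prob_space M" and ind: "indep_vars3 M A X B Y C Z"
    and S: "S \<in> sets A" and T: "T \<in> sets B"
  shows "emeasure M {\<omega> \<in> space M. X \<omega> \<in> S \<and> Y \<omega> \<in> T} = emeasure (distr M A X) S * emeasure (distr M B Y) T"
proof -
  interpret prob_space M by fact
  have X: "X \<in> M \<rightarrow>\<^sub>M A" and Y: "Y \<in> M \<rightarrow>\<^sub>M B"
    and sets: "indep_sets (\<lambda>i::nat. [preimages M A X, preimages M B Y, preimages M C Z] ! i) {0, 1, 2}"
    using ind by (auto simp: indep_vars3_def)
  define E where "E i = (if i = (0::nat) then X -` S \<inter> space M else Y -` T \<inter> space M)" for i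
  have "prob (\<Inter>i\<in>{0, 1}. E i) = (\<Prod>i\<in>{0, 1}. prob (E i))"
    using S T by (intro indep_setsD[OF sets]) (auto simp: E_def preimages_def)
  moreover have "{\<omega> \<in> space M. X \<omega> \<in> S \<and> Y \<omega> \<in> T} = (\<Inter>i\<in>{0, 1}. E i)"
    by (auto simp: E_def)
  ultimately show ?thesis
    using S T X Y by (simp add: E_def emeasure_distr emeasure_eq_measure ennreal_mult)
qed

text \<open>Averaged over a channel event, the conditional mass of \<open>w\<close> gives the
  probability of a joint event, which factors by independence; the constant prior mass has the same
  average. Since \<open>S\<close> is finite, one null set serves for all \<open>w\<close>, and point
  masses determine the law.\<close>

lemma AE_marginal_eq_of_indep:
  assumes M: "prob_space M" and S: "finite S"
    and ind: "indep_vars3 M (count_space S) X B H C Z"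
    and J: "regular_cond_distr M (count_space S \<Otimes>\<^sub>M N) (\<lambda>\<omega>. (X \<omega>, Y \<omega>)) B H J"
  shows "AE h in distr M B H. distr (J h) (count_space S) fst = distr M (count_space S) X"
proof -
  interpret prob_space M by fact
  have XY: "(\<lambda>\<omega>. (X \<omega>, Y \<omega>)) \<in> M \<rightarrow>\<^sub>M count_space S \<Otimes>\<^sub>M N" and H[measurable]: "H \<in> M \<rightarrow>\<^sub>M B"
    and Jm: "J \<in> B \<rightarrow>\<^sub>M prob_algebra (count_space S \<Otimes>\<^sub>M N)"
    and J_rect: "\<And>E T. E \<in> sets (count_space S \<Otimes>\<^sub>M N) \<Longrightarrow> T \<in> sets B \<Longrightarrow>
      emeasure M {\<omega> \<in> space M. (X \<omega>, Y \<omega>) \<in> E \<and> H \<omega> \<in> T} = (\<integral>\<^sup>+ h\<in>T. emeasure (J h) E \<partial>distr M B H)"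
    using J by (auto simp: regular_cond_distr_def)
  have Ys: "Y \<omega> \<in> space N" if "\<omega> \<in> space M" for \<omega>
    using measurable_space[OF XY that] by (simp add: space_pair_measure)
  note Js = regular_cond_distr_kernel[OF J]
  interpret PH: prob_space "distr M B H"
    by (intro prob_space_distr H)
  have "AE h in distr M B H. \<forall>w\<in>S. emeasure (J h) ({w} \<times> space N) = emeasure (distr M (count_space S) X) {w}"
  proof (rule AE_finite_allI[OF S], rule AE_eq_of_set_nn_integral_eq[OF PH.sigma_finite_measure_axioms])
    fix w T assume w: "w \<in> S" and "T \<in> sets (distr M B H)"
    then have T[measurable]: "T \<in> sets B" by simp
    have "(\<integral>\<^sup>+ h\<in>T. emeasure (J h) ({w} \<times> space N) \<partial>distr M B H) =
        emeasure M {\<omega> \<in> space M. (X \<omega>, Y \<omega>) \<in> {w} \<times> space N \<and> H \<omega> \<in> T}"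
      using w by (intro J_rect[symmetric] T) auto
    also have "\<dots> = emeasure M {\<omega> \<in> space M. X \<omega> \<in> {w} \<and> H \<omega> \<in> T}"
      using Ys by (intro arg_cong[where f="emeasure M"]) auto
    also have "\<dots> = emeasure (distr M (count_space S) X) {w} * emeasure (distr M B H) T"
      using w by (intro indep_vars3_emeasure[OF M ind]) auto
    finally show "(\<integral>\<^sup>+ h\<in>T. emeasure (J h) ({w} \<times> space N) \<partial>distr M B H) =
        (\<integral>\<^sup>+ h\<in>T. emeasure (distr M (count_space S) X) {w} \<partial>distr M B H)"
      by (simp add: nn_integral_cmult_indicator)
  next
    fix w assume "w \<in> S"
    then show "(\<lambda>h. emeasure (J h) ({w} \<times> space N)) \<in> borel_measurable (distr M B H)"
      using measurable_prob_algebraD[OF Jm] by measurable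
  qed simp
  then show ?thesis
    using AE_space
  proof eventually_elim
    fix h
    assume eq: "\<forall>w\<in>S. emeasure (J h) ({w} \<times> space N) = emeasure (distr M (count_space S) X) {w}"
      and "h \<in> space (distr M B H)"
    then have h: "h \<in> space B" by simp
    note [measurable_cong] = Js(2)[OF h]
    have spJ: "space (J h) = S \<times> space N"
      using sets_eq_imp_space_eq[OF Js(2)[OF h]] by (simp add: space_pair_measure)
    show "distr (J h) (count_space S) fst = distr M (count_space S) X"
    proof (rule measure_eqI_finite[OF _ _ S])
      fix w assume w: "w \<in> S"
      have "fst -` {w} \<inter> space (J h) = {w} \<times> space N"
        using w by (auto simp: spJ)
      moreover have "fst \<in> J h \<rightarrow>\<^sub>M count_space S" by measurable
      ultimately show "emeasure (distr (J h) (count_space S) fst) {w} = emeasure (distr M (count_space S) X) {w}"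
        using w eq by (simp add: emeasure_distr)
    qed simp_all
  qed
qed

section \<open>The bound for almost every channel coefficient\<close>

theorem theorem1:
  fixes M :: "'w measure"
    and V :: "'v set" and L :: nat and S :: "'v list set"
    and s :: "'w \<Rightarrow> 'v list"
    and h :: "receiver \<Rightarrow> 'w \<Rightarrow> complex"
    and n :: "receiver \<Rightarrow> 'w \<Rightarrow> (complex ^ 'm)"
    and P N b :: real
    and TS :: "'a \<Rightarrow> 'v list \<Rightarrow> 'f" and TC :: "'b \<Rightarrow> 'f \<Rightarrow> (complex ^ 'm)"
    and q :: "receiver \<Rightarrow> 'a \<times> 'b \<times> 'c \<times> 'd \<Rightarrow> 'v list \<Rightarrow> (complex ^ 'm) \<Rightarrow> complex \<Rightarrow> real"
    and \<kappa> :: receiver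
    and \<alpha> :: 'a and \<beta> :: 'b and \<gamma> :: "receiver \<Rightarrow> 'c" and \<delta> :: "receiver \<Rightarrow> 'd"
    and \<phi> :: "'a \<times> 'b \<times> 'c \<times> 'd"
    and y :: "'w \<Rightarrow> (complex ^ 'm)"
    and joint :: "complex \<Rightarrow> ('v list \<times> (complex ^ 'm)) measure"
    and post :: "(complex ^ 'm) \<times> complex \<Rightarrow> 'v list measure"
  assumes "prob_space M"
    and "S = sentences V L"
    and "\<phi> = (\<alpha>, \<beta>, \<gamma> \<kappa>, \<delta> \<kappa>)"
    and "y = received P (transmitted TS TC \<alpha> \<beta>) s (h \<kappa>) (n \<kappa>)"
    and "finite V"
    and "P > 0" and "N > 0" and "b > 1"
    and "\<And>k. indep_vars3 M (count_space S) s borel (h k) borel (n k)"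
    and "\<And>k. distributed M lborel (n k) (\<lambda>z. ennreal (awgn_density N z))"
    and "\<And>k \<theta>. decoder_distribution S (q k \<theta>)"
    and "regular_cond_distr M
           (count_space S \<Otimes>\<^sub>M borel) (\<lambda>\<omega>. (s \<omega>, y \<omega>)) borel (h \<kappa>) joint"
    and "regular_cond_distr M
           (count_space S) s (borel \<Otimes>\<^sub>M borel) (\<lambda>\<omega>. (y \<omega>, h \<kappa> \<omega>)) post"
  shows "AE h0 in distr M borel (h \<kappa>).
      ereal (mutual_info_of_law b S (joint h0))
        \<ge> ereal (prob_space.entropy M b (count_space S) s)
           + ereal_expectation (joint h0) (\<lambda>(w, y0). elog b (q \<kappa> \<phi> w y0 h0))
    \<and> ereal (prob_space.entropy M b (count_space S) s)
        + ereal_expectation (joint h0) (\<lambda>(w, y0). elog b (q \<kappa> \<phi> w y0 h0))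
      = ereal (prob_space.entropy M b (count_space S) s)
        - ereal_expectation (distr (joint h0) borel snd)
            (\<lambda>y0. cross_entropy_loss b post (q \<kappa> \<phi>) y0 h0)"
proof -
  note M = assms(1) and b = assms(8) and ind = assms(9)[of \<kappa>]
    and J = assms(12) and K = assms(13)
  have S: "finite S"
    using finite_lists_length_eq[OF assms(5), of L] by (simp add: assms(2) sentences_def)
  have qm: "(\<lambda>(y, h). q \<kappa> \<phi> w y h) \<in> borel_measurable (borel \<Otimes>\<^sub>M borel)" if "w \<in> S" for w
    using assms(11)[of \<kappa> \<phi>] that by (auto simp: decoder_distribution_def)
  have qp: "w \<in> S \<Longrightarrow> 0 \<le> q \<kappa> \<phi> w y h" "(\<Sum>w\<in>S. q \<kappa> \<phi> w y h) = 1" for w y h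
    using assms(11)[of \<kappa> \<phi>] by (auto simp: decoder_distribution_def)
  have Km: "post \<in> borel \<Otimes>\<^sub>M borel \<rightarrow>\<^sub>M prob_algebra (count_space S)"
    using K by (simp add: regular_cond_distr_def)
  \<comment> \<open>These two facts are the only source of exceptional channel values; where they
    hold, the rest of the argument works at the individual \<open>h0\<close>.\<close>
  show ?thesis
    using AE_disintegration[OF M S J K] AE_marginal_eq_of_indep[OF M S ind J]
  proof eventually_elim
    fix h0
    assume disint: "\<forall>w\<in>S. \<forall>A\<in>sets borel. emeasure (joint h0) ({w} \<times> A) =
        (\<integral>\<^sup>+ y\<in>A. emeasure (post (y, h0)) {w} \<partial>distr (joint h0) borel snd)"
      and marg: "distr (joint h0) (count_space S) fst = distr M (count_space S) s"
    have Jh: "prob_space (joint h0)" "sets (joint h0) = sets (count_space S \<Otimes>\<^sub>M borel)"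
      using regular_cond_distr_kernel[OF J, of h0] by simp_all
    have Kh: "(\<lambda>y. post (y, h0)) \<in> borel \<rightarrow>\<^sub>M prob_algebra (count_space S)"
      by (rule measurable_compose[OF _ Km]) measurable
    have qh: "(\<lambda>y. q \<kappa> \<phi> w y h0) \<in> borel_measurable borel" if "w \<in> S" for w
      using measurable_compose[OF _ qm[OF that], of "\<lambda>y. (y, h0)" borel] by simp
    have J_eq: "joint h0 = density (count_space S \<Otimes>\<^sub>M distr (joint h0) borel snd) (\<lambda>(w, y). emeasure (post (y, h0)) {w})"
      using disint measurable_prob_algebraD[OF Kh] by (intro disintegration_density[OF S Jh]) auto
    \<comment> \<open>Entropy depends on a variable only through its law, so \<open>marg\<close>
      replaces the entropy under the conditional law by that of the source.\<close>
    have ent: "prob_space.entropy (joint h0) b (count_space S) fst = prob_space.entropy M b (count_space S) s"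
      by (simp add: prob_space.entropy_def M Jh(1) marg)
    \<comment> \<open>The kernel is \<open>post\<close> with its channel argument fixed at
      \<open>h0\<close>. The loss carries its own minus sign, so adding the source entropy to both
      sides of the equation in \<open>bound\<close> gives the second conjunct.\<close>
    note bound = decoder_lower_bound[OF b S Jh Kh J_eq qh qp]
    show "ereal (mutual_info_of_law b S (joint h0))
        \<ge> ereal (prob_space.entropy M b (count_space S) s)
           + ereal_expectation (joint h0) (\<lambda>(w, y0). elog b (q \<kappa> \<phi> w y0 h0))
      \<and> ereal (prob_space.entropy M b (count_space S) s)
        + ereal_expectation (joint h0) (\<lambda>(w, y0). elog b (q \<kappa> \<phi> w y0 h0))
      = ereal (prob_space.entropy M b (count_space S) s)
        - ereal_expectation (distr (joint h0) borel snd)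
            (\<lambda>y0. cross_entropy_loss b post (q \<kappa> \<phi>) y0 h0)"
      using bound by (simp add: mutual_info_of_law_def cross_entropy_loss_def ent minus_ereal_def)
  qed
qed

end
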